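(* Let $G_t$ be a finite weighted bipartite graph whose items carry keyword sets, let $Q$ be a finite set of query keywords, let $k,r$ be positive integers and $\sigma$ a real number. Let $M_i$ be a synopsis entry (a set of user vertices of $G_t$) with aggregated keyword bit vector $M_i.BV_r$, and let $Q.BV$ be the bit vector hashed from the keywords in $Q$. If $$M_i.BV_r\wedge Q.BV=\boldsymbol{0}$$ (bitwise AND), then $M_i$ can be safely pruned; that is, no user vertex $u\in M_i$ belongs to any CD-SBN community of $G_t$ for the parameters $(Q,k,r,\sigma)$.
   Context: A bipartite graph $G$ has two disjoint finite vertex sets $U(G)$ (users) and $L(G)$ (items), and edges $e_{u,v}\in E(G)$ with $u\in U(G)$, $v\in L(G)$; each edge carries a positive integer weight $w_{u,v}$, and each item $v$ has a finite keyword set $v.K$. Subgraphs inherit weights and keyword sets. A butterfly $\Join(u_i,u_j,v_a,v_b)$ in a bipartite graph $g$ consists of two distinct users $u_i,u_j$ and two distinct items $v_a,v_b$ such that all four edges between them lie in $E(g)$. The support $sup(e)$ of an edge $e$ in $g$ is the number of butterflies of $g$ containing $e$. A wedge $\angle(u_i,v,u_j)$ in $g$ is a path $u_i - v - u_j$ in $g$ with $u_i\neq u_j$ users and $v$ an item. The score of a butterfly is $w_{\Join(u_i,u_j,v_a,v_b)}=\min\{w_{u_i,v_a},w_{u_j,v_a}\}\cdot\min\{w_{u_i,v_b},w_{u_j,v_b}\}$. The user relationship score $score_{u_i,u_j}(g)$ is the sum of the scores of all butterflies of $g$ containing both $u_i$ and $u_j$ (each unordered pair $\{v_a,v_b\}$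 counted once). A $(k,r,\sigma)$-bitruss is a connected bipartite subgraph $h$ of $G_t$ together with a center user $u_c\in U(h)$ such that: (Support) every edge of $h$ has support at least $k$ in $h$; (Radius) every user $u_i\in U(h)$ satisfies $dist(u_c,u_i)\le 2r$, with $dist$ the shortest-path distance in $h$; (Score) for every wedge $\angle(u_i,v,u_j)$ in $h$, $score_{u_i,u_j}(h)\ge\sigma$. A CD-SBN community for $(Q,k,r,\sigma)$ is a subgraph $h\subseteq G_t$ with at least one edge that is a $(k,r,\sigma)$-bitruss (for some center) and such that every item $v\in L(h)$ satisfies $v.K\cap Q\neq\emptyset$. Bit vectors: fix $B\ge 1$ and a hash function $f$ from keywords to $\{1,\dots,B\}$. For a keyword set $K$, its bit vector in $\{0,1\}^B$ has $i$-th entry $1$ if and only if some keyword in $K$ is hashed by $f$ to $i$. Let $v.BV$ be the bit vector of $v.K$ and $Q.BV$ the bit vector of $Q$. For a user $u$, $hop(u,2r)$ is the subgraph of $G_t$ induced by all vertices at distance at most $2r$ from $u$, and $u.BV_r=\bigvee_{v\in L(hop(u,2r))}v.BV$ (bitwise OR). For a synopsis entry $M_i$, i.e. the set of users under a node entry of the hierarchical synopsis, $M_i.BV_r=\bigvee_{u\in M_i}u.BV_r$. *)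

theory Defs
  imports Complex_Main "HOL-Library.Extended_Nat" "HOL-Library.FuncSet"
begin

(* Users and items share one vertex type; an edge is the pair (user, item).
   Weights and keyword sets are relevant only on edges and items, respectively. *)
record ('a, 'k) bigraph =
  users :: "'a set"
  items :: "'a set"
  edges :: "('a \<times> 'a) set"
  weight :: "'a \<Rightarrow> 'a \<Rightarrow> nat"
  kws :: "'a \<Rightarrow> 'k set"

definition weighted_bipartite :: "('a, 'k) bigraph \<Rightarrow> bool" where
  "weighted_bipartite g \<longleftrightarrow>
     finite (users g) \<and> finite (items g) \<and> users g \<inter> items g = {} \<and>
     edges g \<subseteq> users g \<times> items g \<and>
     (\<forall>(u, v)\<in>edges g. weight g u v > 0) \<and>
     (\<forall>v\<in>items g. finite (kws g v))"

definition subgraph_of :: "('a, 'k) bigraph \<Rightarrow> ('a, 'k) bigraph \<Rightarrow> bool" where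
  "subgraph_of h g \<longleftrightarrow>
     weighted_bipartite h \<and>
     users h \<subseteq> users g \<and> items h \<subseteq> items g \<and> edges h \<subseteq> edges g \<and>
     (\<forall>(u, v)\<in>edges h. weight h u v = weight g u v) \<and>
     (\<forall>v\<in>items h. kws h v = kws g v)"

definition verts :: "('a, 'k) bigraph \<Rightarrow> 'a set" where
  "verts g = users g \<union> items g"

definition adj :: "('a, 'k) bigraph \<Rightarrow> ('a \<times> 'a) set" where
  "adj g = edges g \<union> (edges g)\<inverse>"

definition graph_connected :: "('a, 'k) bigraph \<Rightarrow> bool" where
  "graph_connected g \<longleftrightarrow> (\<forall>x\<in>verts g. \<forall>y\<in>verts g. (x, y) \<in> (adj g)\<^sup>*)"

(* The least number of edges of a walk from x to y; it is \<infinity> if there is none. *)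
definition graph_dist :: "('a, 'k) bigraph \<Rightarrow> 'a \<Rightarrow> 'a \<Rightarrow> enat" where
  "graph_dist g x y = (INF n\<in>{n. (x, y) \<in> adj g ^^ n}. enat n)"

definition induced_subgraph :: "('a, 'k) bigraph \<Rightarrow> 'a set \<Rightarrow> ('a, 'k) bigraph" where
  "induced_subgraph g S =
     g\<lparr>users := users g \<inter> S, items := items g \<inter> S, edges := edges g \<inter> (S \<times> S)\<rparr>"

definition hop :: "('a, 'k) bigraph \<Rightarrow> 'a \<Rightarrow> nat \<Rightarrow> ('a, 'k) bigraph" where
  "hop g u d = induced_subgraph g {x \<in> verts g. graph_dist g u x \<le> enat d}"

definition is_butterfly :: "('a, 'k) bigraph \<Rightarrow> 'a \<Rightarrow> 'a \<Rightarrow> 'a \<Rightarrow> 'a \<Rightarrow> bool" where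
  "is_butterfly g ui uj va vb \<longleftrightarrow>
     ui \<in> users g \<and> uj \<in> users g \<and> ui \<noteq> uj \<and>
     va \<in> items g \<and> vb \<in> items g \<and> va \<noteq> vb \<and>
     {(ui, va), (ui, vb), (uj, va), (uj, vb)} \<subseteq> edges g"

(* The order of the two users and of the two items does not matter when butterflies are
   counted, so a butterfly is represented by its user pair and its item pair as sets. *)
definition butterflies :: "('a, 'k) bigraph \<Rightarrow> ('a set \<times> 'a set) set" where
  "butterflies g = {({ui, uj}, {va, vb}) | ui uj va vb. is_butterfly g ui uj va vb}"

definition support :: "('a, 'k) bigraph \<Rightarrow> 'a \<times> 'a \<Rightarrow> nat" where
  "support g e = card {(A, B) \<in> butterflies g. fst e \<in> A \<and> snd e \<in> B}"

definition butterfly_score :: "('a, 'k) bigraph \<Rightarrow> 'a set \<Rightarrow> 'a set \<Rightarrow> nat" where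
  "butterfly_score g A B = (\<Prod>v\<in>B. Min ((\<lambda>u. weight g u v) ` A))"

lemma butterfly_score_eq:
  assumes "va \<noteq> vb"
  shows "butterfly_score g {ui, uj} {va, vb} =
    min (weight g ui va) (weight g uj va) * min (weight g ui vb) (weight g uj vb)"
  using assms by (simp add: butterfly_score_def)

definition user_score :: "('a, 'k) bigraph \<Rightarrow> 'a \<Rightarrow> 'a \<Rightarrow> nat" where
  "user_score g ui uj =
     (\<Sum>(A, B)\<in>{(A, B) \<in> butterflies g. ui \<in> A \<and> uj \<in> A}. butterfly_score g A B)"

definition is_wedge :: "('a, 'k) bigraph \<Rightarrow> 'a \<Rightarrow> 'a \<Rightarrow> 'a \<Rightarrow> bool" where
  "is_wedge g ui v uj \<longleftrightarrow>
     ui \<in> users g \<and> uj \<in> users g \<and> ui \<noteq> uj \<and> v \<in> items g \<and>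
     (ui, v) \<in> edges g \<and> (uj, v) \<in> edges g"

definition is_bitruss ::
  "('a, 'k) bigraph \<Rightarrow> nat \<Rightarrow> nat \<Rightarrow> real \<Rightarrow> ('a, 'k) bigraph \<Rightarrow> 'a \<Rightarrow> bool" where
  "is_bitruss G k r \<sigma> h uc \<longleftrightarrow>
     subgraph_of h G \<and> graph_connected h \<and> uc \<in> users h \<and>
     (\<forall>e\<in>edges h. support h e \<ge> k) \<and>
     (\<forall>ui\<in>users h. graph_dist h uc ui \<le> enat (2 * r)) \<and>
     (\<forall>ui v uj. is_wedge h ui v uj \<longrightarrow> real (user_score h ui uj) \<ge> \<sigma>)"

definition cd_sbn_community ::
  "('a, 'k) bigraph \<Rightarrow> 'k set \<Rightarrow> nat \<Rightarrow> nat \<Rightarrow> real \<Rightarrow> ('a, 'k) bigraph \<Rightarrow> bool" where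
  "cd_sbn_community G Q k r \<sigma> h \<longleftrightarrow>
     subgraph_of h G \<and> edges h \<noteq> {} \<and>
     (\<exists>uc. is_bitruss G k r \<sigma> h uc) \<and>
     (\<forall>v\<in>items h. kws h v \<inter> Q \<noteq> {})"

(* A bit vector of length B is a function that is False outside {1..B}; bitwise OR, bitwise AND
   and the zero vector are then sup/SUP, inf and bot of the lattice nat => bool. *)
type_synonym bitvec = "nat \<Rightarrow> bool"

definition bit_vector :: "nat \<Rightarrow> ('k \<Rightarrow> nat) \<Rightarrow> 'k set \<Rightarrow> bitvec" where
  "bit_vector B f K = (\<lambda>i. i \<in> {1..B} \<and> (\<exists>x\<in>K. f x = i))"

definition user_BV :: "nat \<Rightarrow> ('k \<Rightarrow> nat) \<Rightarrow> ('a, 'k) bigraph \<Rightarrow> nat \<Rightarrow> 'a \<Rightarrow> bitvec" where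
  "user_BV B f G r u = (SUP v\<in>items (hop G u (2 * r)). bit_vector B f (kws G v))"

definition entry_BV :: "nat \<Rightarrow> ('k \<Rightarrow> nat) \<Rightarrow> ('a, 'k) bigraph \<Rightarrow> nat \<Rightarrow> 'a set \<Rightarrow> bitvec" where
  "entry_BV B f G r M = (SUP u\<in>M. user_BV B f G r u)"

end

theory Submission
  imports Defs
begin

text \<open>
  A community is connected and has an edge, so each of its users \<open>u\<close> is adjacent to some item \<open>v\<close>
  of the community. This item lies within distance \<open>1 \<le> 2 * r\<close> of \<open>u\<close> and carries a query keyword,
  whose hash is a common bit of the two vectors.
\<close>

text \<open>Take a walk from \<open>u\<close> to the user end \<open>x\<close> of some edge. If it
  is empty, then \<open>u = x\<close> and that edge serves; otherwise its first step is an edge at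
  \<open>u\<close>.\<close>

lemma connected_user_has_edge:
  assumes "weighted_bipartite h" "graph_connected h" "edges h \<noteq> {}" "u \<in> users h"
  obtains v where "(u, v) \<in> edges h"
proof -
  from assms(3) obtain x y where xy: "(x, y) \<in> edges h"
    by auto
  then have "x \<in> verts h"
    using assms(1) by (auto simp: weighted_bipartite_def verts_def)
  then have "(u, x) \<in> (adj h)\<^sup>*"
    using assms(2,4) by (auto simp: graph_connected_def verts_def)
  then show thesis
  proof (cases rule: converse_rtranclE)
    case base
    then show thesis using xy that by simp
  next
    case (step z)
    \<comment> \<open>\<open>adj\<close> also contains reversed edges, but a step along one would
      make \<open>u\<close> an item, and users and items are disjoint.\<close>
    then have "(u, z) \<in> edges h"
      using assms(1,4) by (auto simp: adj_def weighted_bipartite_def)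
    then show thesis by (rule that)
  qed
qed

lemma graph_dist_edge_le: "(u, v) \<in> edges g \<Longrightarrow> graph_dist g u v \<le> 1"
  unfolding graph_dist_def one_enat_def by (rule INF_lower) (simp add: adj_def)

lemma item_in_hop:
  assumes "weighted_bipartite g" "(u, v) \<in> edges g" "d > 0"
  shows "v \<in> items (hop g u d)"
proof -
  have "graph_dist g u v \<le> 1"
    using assms(2) by (rule graph_dist_edge_le)
  also have "1 \<le> enat d"
    using assms(3) by (simp add: one_enat_def)
  finally show ?thesis
    using assms(1,2)
    by (auto simp: weighted_bipartite_def hop_def induced_subgraph_def verts_def)
qed

theorem lemma6:
  fixes G :: "('a, 'k) bigraph" and Q :: "'k set" and M :: "'a set"
    and B k r :: nat and \<sigma> :: real and f :: "'k \<Rightarrow> nat"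
  assumes "weighted_bipartite G"
    and "finite Q"
    and "k > 0" and "r > 0"
    and "B \<ge> 1" and "f \<in> UNIV \<rightarrow> {1..B}"
    and "M \<subseteq> users G"
    and "inf (entry_BV B f G r M) (bit_vector B f Q) = bot"
  shows "\<not> (\<exists>u\<in>M. \<exists>h. cd_sbn_community G Q k r \<sigma> h \<and> u \<in> users h)"
proof
  assume "\<exists>u\<in>M. \<exists>h. cd_sbn_community G Q k r \<sigma> h \<and> u \<in> users h"
  then obtain u h where u: "u \<in> M" "u \<in> users h" and h: "cd_sbn_community G Q k r \<sigma> h"
    by blast
  then have sub: "subgraph_of h G" and "edges h \<noteq> {}" "graph_connected h"
    by (auto simp: cd_sbn_community_def is_bitruss_def)
  moreover have bip: "weighted_bipartite h"
    using sub by (simp add: subgraph_of_def)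
  ultimately obtain v where uv: "(u, v) \<in> edges h"
    using u(2) by (metis connected_user_has_edge)
  have v: "v \<in> items h"
    using uv bip by (auto simp: weighted_bipartite_def)
  \<comment> \<open>The hop is formed in \<open>G\<close> rather than in \<open>h\<close>, so the
    edge is moved to \<open>G\<close> before its length is compared with the radius
    \<open>2 * r\<close>.\<close>
  have "(u, v) \<in> edges G"
    using uv sub by (auto simp: subgraph_of_def)
  then have hop: "v \<in> items (hop G u (2 * r))"
    using assms(1,4) by (intro item_in_hop) auto
  have "kws h v \<inter> Q \<noteq> {}" "kws h v = kws G v"
    using h v sub by (auto simp: cd_sbn_community_def subgraph_of_def)
  then obtain x where x: "x \<in> kws G v" "x \<in> Q"
    by auto
  \<comment> \<open>The range matters because \<open>bit_vector\<close> is False outside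
    \<open>{1..B}\<close>.\<close>
  have "f x \<in> {1..B}"
    using assms(6) by auto
  with x have bits: "bit_vector B f (kws G v) (f x)" "bit_vector B f Q (f x)"
    unfolding bit_vector_def by blast+
  \<comment> \<open>The bit of \<open>v\<close> survives both suprema: over the items of the hop,
    then over the users in \<open>M\<close>.\<close>
  have "entry_BV B f G r M (f x)"
    using u(1) hop bits(1) by (auto simp: entry_BV_def user_BV_def)
  with bits(2) have "inf (entry_BV B f G r M) (bit_vector B f Q) (f x)"
    by simp
  then show False
    by (simp add: assms(8))
qed

end
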